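(* Let $\tilde v^*=(v^*,\eta^* )$ be a fixed point of the map $F$ defined in the context, let $z^*=\Pi(v^* )$, $\mu^*=v^*-\Pi(v^* )$, and assume that $v^*_j\notin\{l_j,u_j\}$ for all $j$ and that $I-\nabla_{\tilde v}F(\tilde v^* )$ is nonsingular. Let $\ell$ be a continuously differentiable real-valued loss function of $z^*$, with $\frac{\partial\ell}{\partial z^*}$ its (row-vector) derivative at $z^*$, and let $\hat d_x,\hat d_\eta$ be the vectors defined in the context. Define $\tilde\mu^*\in\mathbb{R}^{d_z}$ by $\tilde\mu^*_j=\mu^*_j$ if $\mu^*_j\ne0$ and $\tilde\mu^*_j=1$ otherwise, and $$\hat d_\lambda=\operatorname{diag}(\rho\tilde\mu^* )^{-1}\Big(-\Big(\frac{\partial\ell}{\partial z^*}\Big)^T-Q\hat d_x-A^T\hat d_\eta\Big).$$ Then the gradients of the loss $\ell$ with respect to the problem variables $l$ and $u$ are $$\frac{\partial\ell}{\partial l}=\operatorname{diag}(\lambda^*_-)\,\hat d_\lambda,\qquad \frac{\partial\ell}{\partial u}=-\operatorname{diag}(\lambda^*_+)\,\hat d_\lambda,$$ where $\lambda^*_-=-\min(\rho\mu^*,0)$ and $\lambda^*_+=\max(\rho\mu^*,0)$ componentwise.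
   Context: Consider the quadratic program: minimize $\tfrac12 z^TQz+z^Tp$ over $z\in\mathbb{R}^{d_z}$ subject to $Az=b$ and $l\le z\le u$ (componentwise). Here $Q\in\mathbb{R}^{d_z\times d_z}$ is symmetric positive definite, $p,l,u\in\mathbb{R}^{d_z}$ with $l\le u$, $A\in\mathbb{R}^{d_{eq}\times d_z}$, $b\in\mathbb{R}^{d_{eq}}$. $\rho>0$ is a fixed penalty parameter; $I_v$ (also written $I$ in $Q+\rho I$) is the $d_z\times d_z$ identity, $I_\eta$ the $d_{eq}\times d_{eq}$ identity, and $I$ in $I-\nabla_{\tilde v}F$ the identity of size $d_z+d_{eq}$. The matrix $\begin{bmatrix}Q+\rho I&A^T\\ A&0\end{bmatrix}$ is assumed nonsingular. $\Pi$ is the projection onto the box: $\Pi(x)_j=l_j$ if $x_j<l_j$, $x_j$ if $l_j\le x_j\le u_j$, $u_j$ if $x_j>u_j$. $D\Pi(x)$ is the diagonal $d_z\times d_z$ matrix whose $j$-th diagonal entry is $1$ if $l_j\le x_j\le u_j$ and $0$ otherwise. The ADMM fixed-point map $F:\mathbb{R}^{d_z}\times\mathbb{R}^{d_{eq}}\to\mathbb{R}^{d_z}\times\mathbb{R}^{d_{eq}}$ is $$F(v,\eta)=-\begin{bmatrix}Q+\rho I & A^T\\ A&0\end{bmatrix}^{-1}\begin{bmatrix}p-\rho(2\Pi(v)-v)\\ -b\end{bmatrix}+\begin{bmatrix}v\\ \eta\end{bmatrix}-\begin{bmatrix}\Pi(v)\\ \eta\end{bmatrix},$$ with Jacobian in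 $\tilde v=(v,\eta)$ $$\nabla_{\tilde v}F=-\begin{bmatrix}Q+\rho I & A^T\\ A&0\end{bmatrix}^{-1}\begin{bmatrix}-\rho(2D\Pi(v)-I_v)&0\\0&0\end{bmatrix}+\begin{bmatrix}I_v&0\\0&I_\eta\end{bmatrix}-\begin{bmatrix}D\Pi(v)&0\\0&I_\eta\end{bmatrix}.$$ At a fixed point, $z^*=\Pi(v^* )$ is the solution of the quadratic program, $\mu^*$ is the scaled ADMM dual variable, and $\lambda^*_-,\lambda^*_+$ are the multipliers of the constraints $l\le z$ and $z\le u$. The vectors $\hat d_x\in\mathbb{R}^{d_z}$, $\hat d_\eta\in\mathbb{R}^{d_{eq}}$ are $$\begin{bmatrix}\hat d_x\\ \hat d_\eta\end{bmatrix}=\begin{bmatrix}Q+\rho I&A^T\\ A&0\end{bmatrix}^{-1}\big[I-\nabla_{\tilde v}F(\tilde v^* )\big]^{-T}\begin{bmatrix}D\Pi(v^* )&0\\0&I_\eta\end{bmatrix}\begin{bmatrix}\big(-\frac{\partial\ell}{\partial z^*}\big)^T\\0\end{bmatrix},$$ where $B^{-T}=(B^{-1})^T$. Gradient convention: the fixed point $\tilde v^*$, and hence $z^*=\Pi(v^* )$, is regarded as the locally defined differentiable implicit function of the problem variables (given by the implicit function theorem applied to $F(\tilde v)-\tilde v=0$; note $\Pi$ depends on $l,u$), and $\ell$ as a function of the problem variables through $z^*$. When $l,u$ vary differentiably (with $l\le u$) and $Q,p,A,b$ are fixed, $d\ell=\langle\frac{\partial\ell}{\partial l},dl\rangle+\langle\frac{\partial\ell}{\partial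 u},du\rangle$. *)

theory Defs
  imports "HOL-Analysis.Analysis"
begin

text \<open>
  The product space R^{d_z} x R^{d_eq} is rendered as \<open>real ^ ('n + 'm)\<close>, so that block
  matrices are ordinary square matrices indexed by a sum type.
\<close>

definition block_vec :: "'a ^ 'n \<Rightarrow> 'a ^ 'm \<Rightarrow> 'a ^ ('n + 'm)" where
  "block_vec x y = (\<chi> k. case k of Inl i \<Rightarrow> x $ i | Inr j \<Rightarrow> y $ j)"

definition upper_part :: "'a ^ ('n::finite + 'm::finite) \<Rightarrow> 'a ^ 'n" where
  "upper_part w = (\<chi> i. w $ Inl i)"

definition lower_part :: "'a ^ ('n::finite + 'm::finite) \<Rightarrow> 'a ^ 'm" where
  "lower_part w = (\<chi> j. w $ Inr j)"

definition block_mat ::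
  "'a ^ 'n ^ 'n \<Rightarrow> 'a ^ 'm ^ 'n \<Rightarrow> 'a ^ 'n ^ 'm \<Rightarrow> 'a ^ 'm ^ 'm \<Rightarrow> 'a ^ ('n + 'm) ^ ('n + 'm)" where
  "block_mat P R S T =
     (\<chi> k. case k of Inl i \<Rightarrow> block_vec (P $ i) (R $ i) | Inr j \<Rightarrow> block_vec (S $ j) (T $ j))"

definition diag :: "'a::zero ^ 'n \<Rightarrow> 'a ^ 'n ^ 'n" where
  "diag x = (\<chi> i j. if i = j then x $ i else 0)"

definition pos_def :: "real ^ 'n ^ 'n \<Rightarrow> bool" where
  "pos_def Q \<longleftrightarrow> (\<forall>x. x \<noteq> 0 \<longrightarrow> x \<bullet> (Q *v x) > 0)"

definition box_proj :: "real ^ 'n \<Rightarrow> real ^ 'n \<Rightarrow> real ^ 'n \<Rightarrow> real ^ 'n" where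
  "box_proj l u x =
     (\<chi> j. if x $ j < l $ j then l $ j else if x $ j \<le> u $ j then x $ j else u $ j)"

definition D_box_proj :: "real ^ 'n \<Rightarrow> real ^ 'n \<Rightarrow> real ^ 'n \<Rightarrow> real ^ 'n ^ 'n" where
  "D_box_proj l u x = diag (\<chi> j. if l $ j \<le> x $ j \<and> x $ j \<le> u $ j then 1 else 0)"

definition kkt_mat :: "real ^ 'n ^ 'n \<Rightarrow> real ^ 'n ^ 'm \<Rightarrow> real \<Rightarrow> real ^ ('n + 'm) ^ ('n + 'm)" where
  "kkt_mat Q A \<rho> = block_mat (Q + \<rho> *\<^sub>R mat 1) (transpose A) A 0"

definition admm_map ::
  "real ^ 'n ^ 'n \<Rightarrow> real ^ 'n \<Rightarrow> real ^ 'n ^ 'm \<Rightarrow> real ^ 'm \<Rightarrow> real \<Rightarrow> real ^ 'n \<Rightarrow> real ^ 'n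
     \<Rightarrow> real ^ ('n + 'm) \<Rightarrow> real ^ ('n + 'm)" where
  "admm_map Q p A b \<rho> l u w =
     (let v = upper_part w; \<eta> = lower_part w in
        - (matrix_inv (kkt_mat Q A \<rho>)
            *v block_vec (p - \<rho> *\<^sub>R (2 *\<^sub>R box_proj l u v - v)) (- b))
        + block_vec v \<eta> - block_vec (box_proj l u v) \<eta>)"

definition admm_jacobian ::
  "real ^ 'n ^ 'n \<Rightarrow> real ^ 'n ^ 'm \<Rightarrow> real \<Rightarrow> real ^ 'n \<Rightarrow> real ^ 'n
     \<Rightarrow> real ^ ('n + 'm) \<Rightarrow> real ^ ('n + 'm) ^ ('n + 'm)" where
  "admm_jacobian Q A \<rho> l u w =
     (let D = D_box_proj l u (upper_part w) in
        - (matrix_inv (kkt_mat Q A \<rho>)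
            ** block_mat (- (\<rho> *\<^sub>R (2 *\<^sub>R D - mat 1))) 0 0 0)
        + block_mat (mat 1) 0 0 (mat 1) - block_mat D 0 0 (mat 1))"

text \<open>
  The stacked vector with blocks \<open>d_x\<close> and \<open>d_eta\<close>; \<open>g\<close> is the gradient of the loss, i.e. the
  transpose of its row-vector derivative.
\<close>

definition adjoint_vec ::
  "real ^ 'n ^ 'n \<Rightarrow> real ^ 'n ^ 'm \<Rightarrow> real \<Rightarrow> real ^ 'n \<Rightarrow> real ^ 'n
     \<Rightarrow> real ^ ('n + 'm) \<Rightarrow> real ^ 'n \<Rightarrow> real ^ ('n + 'm)" where
  "adjoint_vec Q A \<rho> l u w g =
     matrix_inv (kkt_mat Q A \<rho>)
       *v (transpose (matrix_inv (mat 1 - admm_jacobian Q A \<rho> l u w))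
       *v (block_mat (D_box_proj l u (upper_part w)) 0 0 (mat 1)
       *v block_vec (- g) 0))"

definition bounds :: "((real ^ 'n) \<times> (real ^ 'n)) set" where
  "bounds = {(l, u). l \<le> u}"

text \<open>
  \<open>\<phi>\<close> is a differentiable solution, near \<open>(l, u)\<close> and through \<open>w\<close>, of the fixed-point equation
  regarded as an equation for the fixed point as a function of the bounds.
\<close>

definition implicit_fixed_point ::
  "real ^ 'n ^ 'n \<Rightarrow> real ^ 'n \<Rightarrow> real ^ 'n ^ 'm \<Rightarrow> real ^ 'm \<Rightarrow> real \<Rightarrow> real ^ 'n \<Rightarrow> real ^ 'n
     \<Rightarrow> real ^ ('n + 'm) \<Rightarrow> ((real ^ 'n) \<times> (real ^ 'n) \<Rightarrow> real ^ ('n + 'm)) \<Rightarrow> bool" where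
  "implicit_fixed_point Q p A b \<rho> l u w \<phi> \<longleftrightarrow>
     \<phi> (l, u) = w \<and>
     (\<exists>U. open U \<and> (l, u) \<in> U \<and> \<phi> differentiable_on (U \<inter> bounds) \<and>
       (\<forall>(l', u') \<in> U \<inter> bounds. admm_map Q p A b \<rho> l' u' (\<phi> (l', u')) = \<phi> (l', u')))"

text \<open>
  \<open>gl\<close> and \<open>gu\<close> are the gradients of \<open>f\<close> with respect to the two bounds. The derivative is taken
  within \<open>bounds\<close>; that set is convex with nonempty interior, so \<open>gl\<close> and \<open>gu\<close> are unique.
\<close>

definition has_bound_gradients ::
  "((real ^ 'n) \<times> (real ^ 'n) \<Rightarrow> real) \<Rightarrow> real ^ 'n \<Rightarrow> real ^ 'n \<Rightarrow> real ^ 'n \<Rightarrow> real ^ 'n \<Rightarrow> bool" where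
  "has_bound_gradients f l u gl gu \<longleftrightarrow>
     (f has_derivative (\<lambda>(dl, du). gl \<bullet> dl + gu \<bullet> du)) (at (l, u) within bounds)"

end

theory Submission
  imports Defs
begin

text \<open>
  Strict complementarity makes everything locally affine. Where \<open>v\<close> avoids both bounds, the
  projection onto the box \<open>[l', u']\<close> agrees near \<open>(l, u, v)\<close> with \<open>D v' + s(l', u')\<close>: here
  \<open>D\<close> is the 0/1 matrix of the free coordinates, and \<open>s(l', u')\<close> copies, at each clipped
  coordinate, the bound that clips it (\<open>box_proj_locally_affine\<close>). Hence the fixed-point equation
  becomes a linear system \<open>(I - J) w' = c(s(l', u')) + const\<close> with \<open>J\<close> the Jacobian
  (\<open>admm_map_affine\<close>). Since \<open>I - J\<close> is nonsingular, the system has exactly one solution,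
  affine in the bounds. This gives an implicit function without the implicit function theorem, and
  any other implicit function, being continuous at \<open>(l, u)\<close>, stays in the region where the affine
  form is valid and so agrees with that solution near \<open>(l, u)\<close>.

  It remains to differentiate \<open>z = D v + s\<close>. With \<open>K\<close> the KKT matrix,
  \<open>y = (I - J)\<^bsup>-T\<^esup> (- D g, 0)\<close> and \<open>d = K\<^bsup>-1\<^esup> y\<close>, the change of the loss is
  \<open>- y \<bullet> c(s) + g \<bullet> s\<close>. Expanding \<open>c(s)\<close> and \<open>y = K d\<close> gives
  \<open>(g + Q d\<^sub>x + A\<^sup>T d\<^sub>\<eta> - \<rho> d\<^sub>x) \<bullet> s\<close>, and the last term vanishes because the equation
  \<open>(I - J)\<^sup>T y = (- D g, 0)\<close> forces \<open>d\<^sub>x\<close> to be zero at the clipped coordinates, the only ones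
  where \<open>s\<close> lives (\<open>adjoint_identity\<close>). At a coordinate clipped from below one has \<open>\<mu> < 0\<close> and
  \<open>\<lambda>\<^sub>- = - \<rho> \<mu>\<close>, which cancels the factor \<open>1 / (\<rho> \<mu>)\<close> in \<open>d\<^sub>\<lambda>\<close> up to sign; coordinates
  clipped from above are symmetric, and at free coordinates both multipliers are zero.
\<close>

section \<open>Block vectors and block matrices\<close>

lemma upper_part_block_vec [simp]: "upper_part (block_vec x y) = x"
  by (simp add: upper_part_def block_vec_def)

lemma lower_part_block_vec [simp]: "lower_part (block_vec x y) = y"
  by (simp add: lower_part_def block_vec_def)

lemma block_vec_parts [simp]: "block_vec (upper_part w) (lower_part w) = w"
  by (simp add: upper_part_def lower_part_def block_vec_def vec_eq_iff split: sum.splits)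

lemma block_vec_add: "block_vec x y + block_vec x' y' = block_vec (x + x') (y + y')"
  by (simp add: block_vec_def vec_eq_iff split: sum.splits)

lemma block_vec_scaleR:
  fixes x :: "real ^ 'n" and y :: "real ^ 'm"
  shows "c *\<^sub>R block_vec x y = block_vec (c *\<^sub>R x) (c *\<^sub>R y)"
  by (simp add: block_vec_def vec_eq_iff split: sum.splits)

lemma sum_UNIV_Plus:
  fixes f :: "'n::finite + 'm::finite \<Rightarrow> 'b::comm_monoid_add"
  shows "(\<Sum>k\<in>UNIV. f k) = (\<Sum>i\<in>UNIV. f (Inl i)) + (\<Sum>j\<in>UNIV. f (Inr j))"
  by (subst UNIV_Plus_UNIV [symmetric]) (simp add: sum.Plus del: UNIV_Plus_UNIV)

lemma inner_block_vec:
  fixes x x' :: "real ^ 'n" and y y' :: "real ^ 'm"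
  shows "block_vec x y \<bullet> block_vec x' y' = x \<bullet> x' + y \<bullet> y'"
  by (simp add: inner_vec_def sum_UNIV_Plus) (simp add: block_vec_def)

lemma block_mat_mult_block_vec:
  fixes P :: "real ^ 'n ^ 'n" and R :: "real ^ 'm ^ 'n"
    and S :: "real ^ 'n ^ 'm" and T :: "real ^ 'm ^ 'm"
  shows "block_mat P R S T *v block_vec x y = block_vec (P *v x + R *v y) (S *v x + T *v y)"
  by (simp add: vec_eq_iff matrix_vector_mult_def sum_UNIV_Plus)
    (simp add: block_mat_def block_vec_def split: sum.splits)

lemma transpose_block_mat:
  "transpose (block_mat P R S T) = block_mat (transpose P) (transpose S) (transpose R) (transpose T)"
  by (simp add: transpose_def block_mat_def block_vec_def vec_eq_iff split: sum.splits)

lemma block_mat_identity: "block_mat (mat 1) 0 0 (mat 1) = mat 1"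
  by (simp add: mat_def block_mat_def block_vec_def vec_eq_iff split: sum.splits)

lemma linear_upper_part: "linear (upper_part :: real ^ ('n::finite + 'm::finite) \<Rightarrow> real ^ 'n)"
  by (rule linearI) (simp_all add: upper_part_def vec_eq_iff)

lemma linear_block_vec_zero:
  "linear (\<lambda>x :: real ^ 'n. block_vec x (0 :: real ^ 'm))"
  by (rule linearI) (simp_all add: block_vec_add block_vec_scaleR)

section \<open>Inverse, symmetric and diagonal matrices\<close>

lemma invertible_matrix_inv:
  fixes M :: "real ^ 'n ^ 'n"
  assumes "invertible M"
  shows "M ** matrix_inv M = mat 1" "matrix_inv M ** M = mat 1"
  using someI_ex[OF assms[unfolded invertible_def]] by (simp_all add: matrix_inv_def)

lemma mult_eq_iff_eq_matrix_inv_mult: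
  fixes M :: "real ^ 'n ^ 'n"
  assumes "invertible M"
  shows "M *v x = y \<longleftrightarrow> x = matrix_inv M *v y"
  using invertible_matrix_inv[OF assms] by (metis matrix_vector_mul_assoc matrix_vector_mul_lid)

lemma transpose_matrix_inv:
  fixes M :: "real ^ 'n ^ 'n"
  assumes "invertible M"
  shows "transpose M ** transpose (matrix_inv M) = mat 1"
  by (metis assms invertible_matrix_inv(2) matrix_transpose_mul transpose_mat)

lemma symmetric_matrix_inv:
  fixes M :: "real ^ 'n ^ 'n"
  assumes "invertible M" "transpose M = M"
  shows "transpose (matrix_inv M) = matrix_inv M"
  by (metis assms invertible_matrix_inv matrix_mul_assoc matrix_mul_lid matrix_mul_rid
      transpose_matrix_inv)

lemma inner_matrix_mult_left:
  fixes M :: "real ^ 'n ^ 'm"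
  shows "x \<bullet> (M *v y) = (transpose M *v x) \<bullet> y"
  by (simp add: dot_lmul_matrix)

lemma transpose_add: "transpose (M + N) = transpose M + transpose N"
  by (simp add: transpose_def vec_eq_iff)

lemma transpose_diff:
  fixes M N :: "real ^ 'n ^ 'm"
  shows "transpose (M - N) = transpose M - transpose N"
  by (simp add: transpose_def vec_eq_iff)

lemma transpose_uminus:
  fixes M :: "real ^ 'n ^ 'm"
  shows "transpose (- M) = - transpose M"
  by (simp add: transpose_def vec_eq_iff)

lemma transpose_scaleR:
  fixes M :: "real ^ 'n ^ 'm"
  shows "transpose (c *\<^sub>R M) = c *\<^sub>R transpose M"
  by (simp add: transpose_def vec_eq_iff)

lemma transpose_zero: "transpose 0 = 0"
  by (simp add: transpose_def vec_eq_iff)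

lemma transpose_diag [simp]: "transpose (diag x) = diag x"
  by (simp add: transpose_def diag_def vec_eq_iff)

lemma diag_mult_component [simp]:
  fixes x :: "real ^ 'n"
  shows "(diag x *v y) $ j = x $ j * y $ j"
  by (simp add: diag_def matrix_vector_mult_def if_distrib[of "\<lambda>t. t * _"] cong: if_cong)

lemma matrix_inv_diag_mult:
  fixes x :: "real ^ 'n"
  assumes "\<And>j. x $ j \<noteq> 0"
  shows "matrix_inv (diag x) *v y = (\<chi> j. y $ j / x $ j)"
proof -
  have inv: "diag x *v (\<chi> j. y $ j / x $ j) = y" for y
    using assms by (simp add: vec_eq_iff)
  have inv2: "(\<chi> j. (diag x *v y) $ j / x $ j) = y" for y
    using assms by (simp add: vec_eq_iff)
  have "invertible (diag x)"
    unfolding invertible_left_inverse matrix_left_invertible_injective inj_def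
    by (metis inv2)
  then show ?thesis
    using inv mult_eq_iff_eq_matrix_inv_mult by metis
qed

section \<open>The projection near a point off the bounds\<close>

text \<open>
  The coordinates that clip are read off from the reference data \<open>l\<close>, \<open>u\<close>, \<open>v\<close>, while the values
  come from the varying pair of bounds; this makes the function linear in that pair.
\<close>

definition active_bounds ::
  "real ^ 'n \<Rightarrow> real ^ 'n \<Rightarrow> real ^ 'n \<Rightarrow> (real ^ 'n) \<times> (real ^ 'n) \<Rightarrow> real ^ 'n" where
  "active_bounds l u v x =
     (\<chi> j. if v $ j < l $ j then fst x $ j else if u $ j < v $ j then snd x $ j else 0)"

lemma linear_active_bounds: "linear (active_bounds l u v)"
  by (rule linearI) (simp_all add: active_bounds_def vec_eq_iff)

text \<open>
  Each coordinate satisfies one of three strict inequalities, which persist in the limit, so the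
  branch taken by the projection is eventually constant. The filter is arbitrary because the result
  is needed both along full neighbourhoods of the bounds and along \<open>bounds\<close> only.
\<close>

lemma box_proj_locally_affine:
  fixes l u v :: "real ^ 'n"
  assumes "l \<le> u" and off: "\<And>j. v $ j \<notin> {l $ j, u $ j}"
    and ll: "(ll \<longlongrightarrow> l) G" and uu: "(uu \<longlongrightarrow> u) G" and vv: "(vv \<longlongrightarrow> v) G"
  shows "\<forall>\<^sub>F x in G. box_proj (ll x) (uu x) (vv x)
           = D_box_proj l u v *v vv x + active_bounds l u v (ll x, uu x)"
proof -
  have "\<forall>\<^sub>F x in G. box_proj (ll x) (uu x) (vv x) $ j
           = (D_box_proj l u v *v vv x + active_bounds l u v (ll x, uu x)) $ j" for j
  proof -
    have l: "((\<lambda>x. ll x $ j) \<longlongrightarrow> l $ j) G" and u: "((\<lambda>x. uu x $ j) \<longlongrightarrow> u $ j) G"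
      and v: "((\<lambda>x. vv x $ j) \<longlongrightarrow> v $ j) G"
      using ll uu vv by (auto intro: tendsto_vec_nth)
    have le: "l $ j \<le> u $ j" using assms(1) by (simp add: less_eq_vec_def)
    consider "v $ j < l $ j" | "l $ j < v $ j" "v $ j < u $ j" | "u $ j < v $ j"
      using off[of j] by fastforce
    then show ?thesis
    proof cases
      case 1
      have "\<forall>\<^sub>F x in G. vv x $ j < ll x $ j" using order_tendstoD[OF tendsto_diff[OF v l], of 0] 1
        by auto
      then show ?thesis
        by eventually_elim (use 1 in \<open>simp add: box_proj_def D_box_proj_def active_bounds_def\<close>)
    next
      case 2
      have "\<forall>\<^sub>F x in G. ll x $ j < vv x $ j" "\<forall>\<^sub>F x in G. vv x $ j < uu x $ j"
        using order_tendstoD[OF tendsto_diff[OF v l], of 0] order_tendstoD[OF tendsto_diff[OF v u], of 0] 2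
        by auto
      then show ?thesis
        by eventually_elim (use 2 in \<open>simp add: box_proj_def D_box_proj_def active_bounds_def\<close>)
    next
      case 3
      have "\<forall>\<^sub>F x in G. ll x $ j < vv x $ j" "\<forall>\<^sub>F x in G. uu x $ j < vv x $ j"
        \<comment> \<open>The lower bound is tested first, so it must be excluded too; this uses \<open>l \<le> u\<close>.\<close>
        using order_tendstoD[OF tendsto_diff[OF v l], of 0] order_tendstoD[OF tendsto_diff[OF v u], of 0] 3 le
        by auto
      then show ?thesis
        by eventually_elim (use 3 le in \<open>simp add: box_proj_def D_box_proj_def active_bounds_def\<close>)
    qed
  qed
  then show ?thesis by (simp add: vec_eq_iff eventually_all_finite)
qed

section \<open>The fixed-point map with an affine projection\<close>

text \<open>
  The contribution to the fixed-point map of the part \<open>s\<close> of the projection that does not depend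
  on \<open>v\<close>: it enters once through \<open>2 \<rho> \<Pi>(v)\<close> on the right-hand side of the KKT system and once
  through the subtracted \<open>\<Pi>(v)\<close>.
\<close>

definition admm_inhomogeneity ::
  "real ^ 'n ^ 'n \<Rightarrow> real ^ 'n ^ 'm \<Rightarrow> real \<Rightarrow> real ^ 'n \<Rightarrow> real ^ ('n + 'm)" where
  "admm_inhomogeneity Q A \<rho> s =
     matrix_inv (kkt_mat Q A \<rho>) *v block_vec ((2 * \<rho>) *\<^sub>R s) 0 - block_vec s 0"

lemma linear_admm_inhomogeneity: "linear (admm_inhomogeneity Q A \<rho>)"
  by (rule linearI)
    (simp_all add: admm_inhomogeneity_def linear_add[OF linear_block_vec_zero]
      linear_cmul[OF linear_block_vec_zero] matrix_vector_right_distrib matrix_vector_mult_scaleR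
      algebra_simps)

lemma mat_1_minus_admm_jacobian:
  "mat 1 - admm_jacobian Q A \<rho> l u w =
     matrix_inv (kkt_mat Q A \<rho>)
       ** block_mat (- (\<rho> *\<^sub>R (2 *\<^sub>R D_box_proj l u (upper_part w) - mat 1))) 0 0 0
     + block_mat (D_box_proj l u (upper_part w)) 0 0 (mat 1)"
  by (simp add: admm_jacobian_def block_mat_identity Let_def)

text \<open>
  The Jacobian is the linear part of the map whenever the projection is given by its
  linearisation plus a shift \<open>s\<close>; the bounds in the map may differ from those at which the Jacobian
  is taken.
\<close>

lemma admm_map_affine:
  fixes Q :: "real ^ 'n ^ 'n" and A :: "real ^ 'n ^ 'm"
  assumes proj: "box_proj l' u' (upper_part w) = D_box_proj l u (upper_part w0) *v upper_part w + s"
  shows "admm_map Q p A b \<rho> l' u' w =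
    admm_jacobian Q A \<rho> l u w0 *v w + admm_inhomogeneity Q A \<rho> s
      - matrix_inv (kkt_mat Q A \<rho>) *v block_vec p (- b)"
proof -
  define D where "D = D_box_proj l u (upper_part w0)"
  define x where "x = upper_part w"
  define y where "y = lower_part w"
  have w: "w = block_vec x y" by (simp add: x_def y_def)
  let ?B = "block_mat (- (\<rho> *\<^sub>R (2 *\<^sub>R D - mat 1))) 0 0 (0 :: real ^ 'm ^ 'm)"
  have "block_vec (p - \<rho> *\<^sub>R (2 *\<^sub>R (D *v x + s) - x)) (- b) =
      ?B *v w + block_vec p (- b) + (- 1) *\<^sub>R block_vec ((2 * \<rho>) *\<^sub>R s) 0"
    by (simp add: w block_mat_mult_block_vec block_vec_add block_vec_scaleR
      matrix_vector_mult_diff_rdistrib scaleR_matrix_vector_assoc[symmetric] algebra_simps 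
      del: scaleR_minus1_left)
  then have rhs: "block_vec (p - \<rho> *\<^sub>R (2 *\<^sub>R (D *v x + s) - x)) (- b) =
      ?B *v w + block_vec p (- b) - block_vec ((2 * \<rho>) *\<^sub>R s) 0" by simp
  have shift: "block_vec (D *v x + s) y = block_mat D 0 0 (mat 1) *v w + block_vec s 0"
    by (simp add: w block_mat_mult_block_vec block_vec_add)
  show ?thesis
    using proj
    by (simp add: admm_map_def admm_jacobian_def Let_def admm_inhomogeneity_def block_mat_identity
      x_def[symmetric] y_def[symmetric] D_def[symmetric] rhs shift w[symmetric]
      matrix_vector_mult_add_rdistrib matrix_vector_mult_diff_rdistrib
      matrix_vector_right_distrib matrix_vector_mult_diff_distrib 
      matrix_vector_mul_assoc[symmetric])
qed

section \<open>The adjoint identity\<close>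

text \<open>
  The left-hand side is the derivative of the loss when the clipped coordinates of \<open>z\<close> move by
  \<open>s\<close> and the free ones follow through the fixed-point equation. Transposing \<open>(I - J)\<^bsup>-1\<^esup>\<close> onto \<open>g\<close>
  turns it into an expression in the adjoint vector. The hypothesis \<open>D s = 0\<close> says that \<open>s\<close> is
  supported on the clipped coordinates, where the adjoint \<open>d_x\<close> vanishes.
\<close>

lemma adjoint_identity:
  fixes Q :: "real ^ 'n ^ 'n" and A :: "real ^ 'n ^ 'm"
  assumes symQ: "transpose Q = Q" and "\<rho> \<noteq> 0"
    and K: "invertible (kkt_mat Q A \<rho>)"
    and J: "invertible (mat 1 - admm_jacobian Q A \<rho> l u w)"
    and s: "D_box_proj l u (upper_part w) *v s = 0"
    and dx: "d_x = upper_part (adjoint_vec Q A \<rho> l u w g)"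
    and de: "d_eta = lower_part (adjoint_vec Q A \<rho> l u w g)"
  shows "g \<bullet> (D_box_proj l u (upper_part w)
            *v upper_part (matrix_inv (mat 1 - admm_jacobian Q A \<rho> l u w)
                 *v admm_inhomogeneity Q A \<rho> s) + s)
         = (g + Q *v d_x + transpose A *v d_eta) \<bullet> s"
proof -
  define Dvec where "Dvec =
    (\<chi> j. if l $ j \<le> upper_part w $ j \<and> upper_part w $ j \<le> u $ j then 1 else (0::real))"
  define D where "D = D_box_proj l u (upper_part w)"
  have D: "D = diag Dvec" by (simp add: D_def D_box_proj_def Dvec_def)
  let ?K = "kkt_mat Q A \<rho>" and ?M = "mat 1 - admm_jacobian Q A \<rho> l u w"
  let ?B = "block_mat (- (\<rho> *\<^sub>R (2 *\<^sub>R D - mat 1))) 0 0 (0 :: real ^ 'm ^ 'm)"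
  let ?E = "block_mat D 0 0 (mat 1 :: real ^ 'm ^ 'm)"
  define y where "y = transpose (matrix_inv ?M) *v (?E *v block_vec (- g) 0)"
  define d where "d = block_vec d_x d_eta"
  have d: "d = matrix_inv ?K *v y"
    by (simp add: d_def dx de y_def D_def adjoint_vec_def)
  have symD: "transpose D = D" by (simp add: D)
  have symK: "transpose ?K = ?K"
    by (simp add: kkt_mat_def transpose_block_mat transpose_add transpose_scaleR transpose_zero
        transpose_mat symQ)
  have symB: "transpose ?B = ?B"
    by (simp add: transpose_block_mat transpose_uminus transpose_diff transpose_scaleR
        transpose_zero transpose_mat symD)
  have symE: "transpose ?E = ?E"
    by (simp add: transpose_block_mat transpose_zero transpose_mat symD)
  have y: "y = ?K *v d" using mult_eq_iff_eq_matrix_inv_mult[OF K] d by metis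
  have M: "?M = matrix_inv ?K ** ?B + ?E" by (simp add: mat_1_minus_admm_jacobian D_def)
  have "transpose ?M *v y = ?E *v block_vec (- g) 0"
    unfolding y_def matrix_vector_mul_assoc[of "transpose ?M"] transpose_matrix_inv[OF J] by simp
  moreover have "transpose ?M = ?B ** matrix_inv ?K + ?E"
  proof -
    have "transpose ?M = transpose (matrix_inv ?K ** ?B) + transpose ?E"
      unfolding M by (simp add: transpose_add)
    then show ?thesis by (simp add: matrix_transpose_mul symB symE symmetric_matrix_inv[OF K symK])
  qed
  ultimately have adj: "?B *v d + ?E *v y = ?E *v block_vec (- g) 0"
    by (simp add: matrix_vector_mult_add_rdistrib matrix_vector_mul_assoc[symmetric] d)
  define yx where "yx = upper_part y"
  have yx: "yx = Q *v d_x + \<rho> *\<^sub>R d_x + transpose A *v d_eta"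
    unfolding yx_def y d_def
    by (simp add: kkt_mat_def block_mat_mult_block_vec matrix_vector_mult_add_rdistrib
      scaleR_matrix_vector_assoc[symmetric])
  have y_block: "y = block_vec yx (lower_part y)" by (simp add: yx_def)
  have "upper_part (?B *v d + ?E *v y) = upper_part (?E *v block_vec (- g) 0)" using adj by simp
  then have stat: "- \<rho> *\<^sub>R (2 *\<^sub>R (D *v d_x) - d_x) + D *v yx = D *v (- g)"
    by (subst (asm) y_block) (simp add: d_def block_mat_mult_block_vec block_vec_add
        matrix_vector_mult_diff_rdistrib scaleR_matrix_vector_assoc[symmetric] algebra_simps)
  \<comment> \<open>At a clipped coordinate \<open>stat\<close> reduces to \<open>\<rho> * d_x $ j = 0\<close>.\<close>
  have "d_x $ j * s $ j = 0" for j
  proof (cases "Dvec $ j = 0")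
    case True
    have "(- \<rho> *\<^sub>R (2 *\<^sub>R (D *v d_x) - d_x) + D *v yx) $ j = (D *v (- g)) $ j"
      by (simp only: stat)
    then show ?thesis using True \<open>\<rho> \<noteq> 0\<close> by (simp add: D)
  next
    case False
    have "(D *v s) $ j = 0" using s D_def by simp
    then show ?thesis using False by (simp add: D)
  qed
  then have ortho: "d_x \<bullet> s = 0" by (simp only: inner_vec_def inner_real_def sum.neutral_const)
  let ?c = "admm_inhomogeneity Q A \<rho> s"
  have "g \<bullet> (D *v upper_part (matrix_inv ?M *v ?c))
      = - ((?E *v block_vec (- g) 0) \<bullet> (matrix_inv ?M *v ?c))"
  proof -
    have "(?E *v block_vec (- g) 0) \<bullet> r = - (g \<bullet> (D *v upper_part r))" for r
    proof -
      have "(?E *v block_vec (- g) 0) \<bullet> block_vec (upper_part r) (lower_part r)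
          = - (g \<bullet> (D *v upper_part r))"
        unfolding block_mat_mult_block_vec inner_block_vec
        by (simp add: inner_matrix_mult_left[of g] symD linear_neg[OF matrix_vector_mul_linear])
      then show ?thesis by simp
    qed
    then show ?thesis by simp
  qed
  also have "\<dots> = - (y \<bullet> ?c)"
    by (simp add: y_def inner_matrix_mult_left)
  also have "y \<bullet> ?c = d \<bullet> block_vec ((2 * \<rho>) *\<^sub>R s) 0 - y \<bullet> block_vec s 0"
    by (simp add: admm_inhomogeneity_def inner_diff_right inner_matrix_mult_left
      symmetric_matrix_inv[OF K symK] d)
  also have "\<dots> = 2 * \<rho> * (d_x \<bullet> s) - yx \<bullet> s"
    by (subst y_block) (simp add: d_def inner_block_vec)
  finally show ?thesis
    unfolding D_def[symmetric] by (simp add: inner_add_right inner_add_left yx ortho)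
qed

section \<open>Gradients with respect to the bounds\<close>

theorem proposition3:
  fixes Q :: "real ^ 'n ^ 'n" and p l u :: "real ^ 'n"
    and A :: "real ^ 'n ^ 'm" and b :: "real ^ 'm" and \<rho> :: real
    and v :: "real ^ 'n" and \<eta> :: "real ^ 'm"
    and loss :: "real ^ 'n \<Rightarrow> real" and grad_loss :: "real ^ 'n \<Rightarrow> real ^ 'n"
    and z \<mu> mu_t g d_x d_lam lam_minus lam_plus :: "real ^ 'n" and d_eta :: "real ^ 'm"
  assumes "transpose Q = Q" and "pos_def Q" and "l \<le> u" and "\<rho> > 0"
    and "invertible (kkt_mat Q A \<rho>)"
    and "admm_map Q p A b \<rho> l u (block_vec v \<eta>) = block_vec v \<eta>"
    and "\<And>j. v $ j \<notin> {l $ j, u $ j}"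
    and "invertible (mat 1 - admm_jacobian Q A \<rho> l u (block_vec v \<eta>))"
    and "\<And>x. GDERIV loss x :> grad_loss x" and "continuous_on UNIV grad_loss"
    and "z = box_proj l u v" and "\<mu> = v - box_proj l u v"
    and "g = grad_loss z"
    and "d_x = upper_part (adjoint_vec Q A \<rho> l u (block_vec v \<eta>) g)"
    and "d_eta = lower_part (adjoint_vec Q A \<rho> l u (block_vec v \<eta>) g)"
    and "mu_t = (\<chi> j. if \<mu> $ j \<noteq> 0 then \<mu> $ j else 1)"
    and "d_lam = matrix_inv (diag (\<rho> *\<^sub>R mu_t)) *v (- g - Q *v d_x - transpose A *v d_eta)"
    and "lam_minus = (\<chi> j. - min (\<rho> * \<mu> $ j) 0)"
    and "lam_plus = (\<chi> j. max (\<rho> * \<mu> $ j) 0)"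
  shows "(\<exists>\<phi>. implicit_fixed_point Q p A b \<rho> l u (block_vec v \<eta>) \<phi>) \<and>
    (\<forall>\<phi>. implicit_fixed_point Q p A b \<rho> l u (block_vec v \<eta>) \<phi> \<longrightarrow>
      has_bound_gradients (\<lambda>(l', u'). loss (box_proj l' u' (upper_part (\<phi> (l', u'))))) l u
        (diag lam_minus *v d_lam) (- (diag lam_plus *v d_lam)))"
proof -
  define w where "w = block_vec v \<eta>"
  define D where "D = D_box_proj l u v"
  define M where "M = mat 1 - admm_jacobian Q A \<rho> l u w"
  define \<phi>0 where "\<phi>0 x = matrix_inv M *v (admm_inhomogeneity Q A \<rho> (active_bounds l u v x)
      - matrix_inv (kkt_mat Q A \<rho>) *v block_vec p (- b))" for x
  let ?S = "active_bounds l u v"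
  let ?proj = "\<lambda>x w'. box_proj (fst x) (snd x) (upper_part w') = D *v upper_part w' + ?S x"
  have upw: "upper_part w = v" by (simp add: w_def)
  have M: "invertible M" using assms(8) by (simp add: M_def w_def)
  have fixed_iff: "admm_map Q p A b \<rho> (fst x) (snd x) w' = w' \<longleftrightarrow> w' = \<phi>0 x"
    if "?proj x w'" for x w'
  proof -
    have "admm_map Q p A b \<rho> (fst x) (snd x) w' =
       admm_jacobian Q A \<rho> l u w *v w' + admm_inhomogeneity Q A \<rho> (?S x)
      - matrix_inv (kkt_mat Q A \<rho>) *v block_vec p (- b)"
      using that by (intro admm_map_affine) (simp add: D_def upw)
    moreover have "M *v w' = w' - admm_jacobian Q A \<rho> l u w *v w'"
      by (simp add: M_def matrix_vector_mult_diff_rdistrib)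
    moreover have "a + c - k = e \<longleftrightarrow> e - a = c - k" for a c k e :: "real ^ ('n + 'm)"
      by (auto simp: algebra_simps)
    ultimately have "admm_map Q p A b \<rho> (fst x) (snd x) w' = w' \<longleftrightarrow>
        M *v w' = admm_inhomogeneity Q A \<rho> (?S x)
          - matrix_inv (kkt_mat Q A \<rho>) *v block_vec p (- b)"
      by metis
    then show ?thesis using mult_eq_iff_eq_matrix_inv_mult[OF M] by (simp add: \<phi>0_def)
  qed
  have proj_near: "\<forall>\<^sub>F x in F. ?proj x (\<psi> x)"
    if "(\<psi> \<longlongrightarrow> w) F" "F \<le> nhds (l, u)" for \<psi> F
  proof -
    have id: "((\<lambda>x. x) \<longlongrightarrow> (l, u)) F" using that(2) by (simp add: filterlim_def)
    have "((\<lambda>x. upper_part (\<psi> x)) \<longlongrightarrow> v) F"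
      using bounded_linear.tendsto[OF linear_conv_bounded_linear[THEN iffD1, OF linear_upper_part]
          that(1)] by (simp add: upw)
    from box_proj_locally_affine[OF assms(3,7) _ _ this, of fst snd]
    show ?thesis using tendsto_fst[OF id] tendsto_snd[OF id] by (simp add: D_def)
  qed
  \<comment> \<open>An eventual property on a full neighbourhood holds at the point itself, so the affine form of
    the projection is exact at \<open>(l, u)\<close>.\<close>
  have \<phi>0_w: "\<phi>0 (l, u) = w"
  proof -
    have "?proj (l, u) w"
      using eventually_nhds_x_imp_x[OF proj_near[OF tendsto_const order.refl]] by simp
    then show ?thesis using fixed_iff[of "(l, u)" w] assms(6) by (simp add: w_def)
  qed
  define L where "L h = matrix_inv M *v admm_inhomogeneity Q A \<rho> (?S h)" for h
  have linL: "linear L"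
    unfolding L_def
    by (rule linear_compose[unfolded o_def, OF linear_active_bounds
        linear_compose[unfolded o_def, OF linear_admm_inhomogeneity matrix_vector_mul_linear]])
  have \<phi>0_deriv: "(\<phi>0 has_derivative L) F" for F
  proof -
    have "\<phi>0 = (\<lambda>x. L x - matrix_inv M *v (matrix_inv (kkt_mat Q A \<rho>) *v block_vec p (- b)))"
      by (simp add: \<phi>0_def L_def matrix_vector_mult_diff_distrib fun_eq_iff)
    then show ?thesis using linL
      by (auto intro!: derivative_eq_intros linear_imp_has_derivative)
  qed
  have "\<exists>\<phi>. implicit_fixed_point Q p A b \<rho> l u w \<phi>"
  proof -
    have "(\<phi>0 \<longlongrightarrow> w) (nhds (l, u))"
      using has_derivative_continuous[OF \<phi>0_deriv, of "(l, u)" UNIV] \<phi>0_w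
      by (metis isCont_def tendsto_at_iff_tendsto_nhds)
    from proj_near[OF this order.refl] obtain U where U: "open U" "(l, u) \<in> U"
      "\<And>x. x \<in> U \<Longrightarrow> ?proj x (\<phi>0 x)"
      unfolding eventually_nhds by blast
    have "\<phi>0 differentiable_on (U \<inter> bounds)"
      unfolding differentiable_on_def differentiable_def using \<phi>0_deriv by blast
    moreover have "admm_map Q p A b \<rho> l' u' (\<phi>0 (l', u')) = \<phi>0 (l', u')" if "(l', u') \<in> U" for l' u'
      using fixed_iff[of "(l', u')" "\<phi>0 (l', u')"] U(3)[OF that] by simp
    ultimately show ?thesis
      unfolding implicit_fixed_point_def using U(1,2) \<phi>0_w by blast
  qed
  moreover have "has_bound_gradients (\<lambda>(l', u'). loss (box_proj l' u' (upper_part (\<phi> (l', u'))))) l u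
        (diag lam_minus *v d_lam) (- (diag lam_plus *v d_lam))"
    if \<phi>: "implicit_fixed_point Q p A b \<rho> l u w \<phi>" for \<phi>
  proof -
    obtain U where \<phi>w: "\<phi> (l, u) = w" and U: "open U" "(l, u) \<in> U"
      and diff: "\<phi> differentiable_on (U \<inter> bounds)"
      and fp: "\<And>x. x \<in> U \<inter> bounds \<Longrightarrow> admm_map Q p A b \<rho> (fst x) (snd x) (\<phi> x) = \<phi> x"
      using \<phi> unfolding implicit_fixed_point_def by fastforce
    have lu: "(l, u) \<in> bounds" using assms(3) by (simp add: bounds_def)
    have at_U: "at (l, u) within (U \<inter> bounds) = at (l, u) within bounds"
      using at_within_nhd[OF U(2,1), of "U \<inter> bounds" bounds] by auto
    have "continuous (at (l, u) within bounds) \<phi>"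
      using differentiable_imp_continuous_on[OF diff, unfolded continuous_on_eq_continuous_within,
          rule_format, OF IntI[OF U(2) lu]]
      by (simp only: at_U)
    then have "(\<phi> \<longlongrightarrow> w) (at (l, u) within bounds)" by (simp add: continuous_within \<phi>w)
    from proj_near[OF this] have "\<forall>\<^sub>F x in at (l, u) within bounds. ?proj x (\<phi> x)"
      by (simp add: at_within_def)
    moreover have "\<forall>\<^sub>F x in at (l, u) within bounds. x \<in> U \<inter> bounds"
      unfolding eventually_at_topological using U by blast
    \<comment> \<open>This is the local uniqueness of the implicit function: \<open>\<phi>\<close> may be replaced by \<open>\<phi>0\<close>.\<close>
    ultimately have z_affine: "\<forall>\<^sub>F x in at (l, u) within bounds.
        box_proj (fst x) (snd x) (upper_part (\<phi> x)) = D *v upper_part (\<phi>0 x) + ?S x"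
    proof eventually_elim
      case (elim x)
      then show ?case using fixed_iff[OF elim(1)] fp[OF elim(2)] by simp
    qed
    have z0: "z = D *v upper_part (\<phi>0 (l, u)) + ?S (l, u)"
      using eventually_nhds_x_imp_x[OF proj_near[OF tendsto_const order.refl]] \<phi>0_w upw assms(11)
      by simp
    let ?dz = "\<lambda>h. D *v upper_part (L h) + ?S h"
    have "((\<lambda>x. D *v upper_part (\<phi>0 x) + ?S x) has_derivative ?dz) (at (l, u) within bounds)"
    proof (rule has_derivative_add)
      have lin: "linear (\<lambda>w'. D *v upper_part w')"
        by (rule linear_compose[unfolded o_def, OF linear_upper_part matrix_vector_mul_linear])
      show "((\<lambda>x. D *v upper_part (\<phi>0 x)) has_derivative (\<lambda>h. D *v upper_part (L h)))
          (at (l, u) within bounds)"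
        by (rule bounded_linear.has_derivative[OF linear_conv_bounded_linear[THEN iffD1, OF lin]
              \<phi>0_deriv])
      show "(?S has_derivative ?S) (at (l, u) within bounds)"
        by (rule linear_imp_has_derivative[OF linear_active_bounds])
    qed
    moreover have "(loss has_derivative (\<lambda>h. h \<bullet> g)) (at z)"
      using assms(9)[of z] by (simp add: gderiv_def assms(13))
    ultimately have "((\<lambda>x. loss (D *v upper_part (\<phi>0 x) + ?S x)) has_derivative (\<lambda>h. ?dz h \<bullet> g))
        (at (l, u) within bounds)"
      unfolding z0 by (rule has_derivative_compose)
    then have deriv: "((\<lambda>x. loss (box_proj (fst x) (snd x) (upper_part (\<phi> x))))
        has_derivative (\<lambda>h. ?dz h \<bullet> g)) (at (l, u) within bounds)"
    proof (rule has_derivative_transform_eventually)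
      show "\<forall>\<^sub>F x in at (l, u) within bounds. loss (D *v upper_part (\<phi>0 x) + ?S x)
          = loss (box_proj (fst x) (snd x) (upper_part (\<phi> x)))"
        using z_affine by eventually_elim simp
      show "loss (D *v upper_part (\<phi>0 (l, u)) + ?S (l, u))
          = loss (box_proj (fst (l, u)) (snd (l, u)) (upper_part (\<phi> (l, u))))"
        using z0 assms(11) \<phi>w upw by simp
    qed (rule lu)
    let ?q = "g + Q *v d_x + transpose A *v d_eta"
    have grad: "?dz h \<bullet> g = (diag lam_minus *v d_lam) \<bullet> fst h + (- (diag lam_plus *v d_lam)) \<bullet> snd h"
      for h
    proof -
      \<comment> \<open>\<open>D\<close> keeps free coordinates, \<open>?S h\<close> lives on clipped ones.\<close>
      have clipped: "D *v ?S h = 0"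
        by (auto simp: D_def D_box_proj_def active_bounds_def vec_eq_iff)
      have "?dz h \<bullet> g = ?q \<bullet> ?S h"
        using adjoint_identity[of Q \<rho> A l u w "?S h" d_x g d_eta] assms(1,4,5,14,15) M clipped
        by (simp add: D_def M_def L_def upw w_def inner_commute)
      also have "\<dots> = (\<Sum>j\<in>UNIV. (diag lam_minus *v d_lam) $ j * fst h $ j
          + (- (diag lam_plus *v d_lam)) $ j * snd h $ j)"
        unfolding inner_vec_def
      proof (rule sum.cong[OF refl])
        fix j
        have le: "l $ j \<le> u $ j" using assms(3) by (simp add: less_eq_vec_def)
        have d_lam: "d_lam $ j = - ?q $ j / (\<rho> * mu_t $ j)"
        proof -
          have "(\<rho> *\<^sub>R mu_t) $ j \<noteq> 0" for j using \<open>\<rho> > 0\<close> by (simp add: assms(16))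
          then show ?thesis unfolding assms(17) by (simp add: matrix_inv_diag_mult)
        qed
        have lam: "lam_minus $ j = - min (\<rho> * \<mu> $ j) 0" "lam_plus $ j = max (\<rho> * \<mu> $ j) 0"
          by (simp_all add: assms(18,19))
        have mu: "\<mu> $ j = (if v $ j < l $ j then v $ j - l $ j
            else if u $ j < v $ j then v $ j - u $ j else 0)"
          using le by (auto simp: assms(12) box_proj_def)
        have S: "?S h $ j = (if v $ j < l $ j then fst h $ j
            else if u $ j < v $ j then snd h $ j else 0)"
          by (simp add: active_bounds_def)
        have "?q $ j * ?S h $ j = lam_minus $ j * d_lam $ j * fst h $ j
            - lam_plus $ j * d_lam $ j * snd h $ j"
        proof (cases "\<mu> $ j" "0 :: real" rule: linorder_cases)
          case less
          then have "v $ j < l $ j" using mu by (auto split: if_splits)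
          moreover have "lam_minus $ j * d_lam $ j = ?q $ j" "lam_plus $ j = 0"
            using less \<open>\<rho> > 0\<close> mult_pos_neg[OF \<open>\<rho> > 0\<close> less]
            by (simp_all add: d_lam lam assms(16))
          ultimately show ?thesis by (simp add: S)
        next
          case equal
          then have "?S h $ j = 0" using mu S by (auto split: if_splits)
          then show ?thesis using equal by (simp add: lam)
        next
          case greater
          then have upper: "?S h $ j = snd h $ j" using mu S by (auto split: if_splits)
          have lam_plus: "lam_plus $ j * d_lam $ j = - ?q $ j" and lam_minus: "lam_minus $ j = 0"
            using greater \<open>\<rho> > 0\<close> mult_pos_pos[OF \<open>\<rho> > 0\<close> greater]
            by (simp_all add: d_lam lam assms(16))
          show ?thesis
            unfolding upper lam_plus lam_minus
            by (simp only: mult_zero_left vector_uminus_component mult_minus_left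
                diff_minus_eq_add add_0_left)
        qed
        then show "?q $ j \<bullet> ?S h $ j = (diag lam_minus *v d_lam) $ j * fst h $ j
          + (- (diag lam_plus *v d_lam)) $ j * snd h $ j"
          by simp
      qed
      finally show ?thesis by (simp only: inner_vec_def inner_real_def sum.distrib)
    qed
    show ?thesis
      using deriv unfolding has_bound_gradients_def grad by (simp add: case_prod_unfold)
  qed
  ultimately show ?thesis by (simp add: w_def)
qed

end
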